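(* Let $K$ be a positive integer, let $p\in\mathbb{Z}$ with $p\ne 0$, and set $q=2K(2pK+1)$. Then \[ f\left(\tfrac{1}{2}\sqrt{p/q}\right)=\begin{cases}1/2 & \text{if } p \text{ is even},\\ 1/2-K/q & \text{if } p \text{ is odd},\end{cases} \] where $f(r)=\frac{4}{\pi^2}\sum_{k\ge0}\frac{\sec((2k+1)\pi r)}{(2k+1)^2}$.
   Context: The function $f$ is defined by $f(r)=\frac{4}{\pi^2}\sum_{k\ge0}\frac{\sec((2k+1)\pi r)}{(2k+1)^2}$, with $\sec x=1/\cos x$. Note that $p/q>0$ for all admissible $p,K$ (if $p<0$ then also $q<0$), so $\tfrac12\sqrt{p/q}$ is a positive real number. (For instance $K=1,p=-1$ gives $f(1/\sqrt{8})=1$.) *)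

theory Defs
  imports "HOL-Analysis.Analysis"
begin

definition sec :: "real \<Rightarrow> real" where
  "sec x = 1 / cos x"

definition f_term :: "real \<Rightarrow> nat \<Rightarrow> real" where
  "f_term r k = sec ((2 * real k + 1) * pi * r) / (2 * real k + 1) ^ 2"

definition f :: "real \<Rightarrow> real" where
  "f r = 4 / pi ^ 2 * (\<Sum>k. f_term r k)"

end

theory Submission
  imports Defs
begin

text \<open>
  Put \<open>S(y) = \<Sum> sec(\<pi> n y / 2) / n\<^sup>2\<close> and \<open>T(x) = \<Sum> \<chi>(m) tan(\<pi> m x / 2) / m\<^sup>2\<close>, summed over
  odd positive \<open>n\<close> and \<open>m\<close>, where \<open>\<chi>\<close> is the nontrivial character modulo 4. Expanding the secant
  and the tangent into partial fractions turns \<open>S(1/x)\<close> and \<open>T(x)\<close>, up to elementary terms, into the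
  two iterated sums of \<open>\<chi>(m) / (m (n\<^sup>2 - m\<^sup>2 x\<^sup>2))\<close>. If \<open>x\<close> is badly approximable, this double
  series converges absolutely, and so \<open>S(1/x) + T(x)/x = \<pi>\<^sup>2/8\<close>.

  Moreover \<open>T(x + 2) = T(x)\<close> and \<open>S(y + 2) = - S(y)\<close>. For \<open>\<beta> = sqrt(q/p)\<close> the numbers
  \<open>\<gamma> = \<beta> - 2K\<close> and \<open>\<delta> = \<beta> + 2K\<close> satisfy \<open>1/\<gamma> = 1/\<delta> + 2p\<close>. Hence
  \<open>T(\<beta>) = T(\<gamma>) = T(\<delta>)\<close> and \<open>S(1/\<gamma>) = (-1)\<^sup>p S(1/\<delta>)\<close>, and the reciprocity at \<open>\<gamma>\<close> and \<open>\<delta>\<close>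
  becomes a linear equation for \<open>T(\<beta>)\<close>; the reciprocity at \<open>\<beta>\<close> then gives \<open>S(1/\<beta>)\<close>.
\<close>

section \<open>Partial fractions\<close>

text \<open>Differentiate \<open>rGamma z * rGamma (1 - z) = sin (pi * z) / pi\<close> on both
  sides. The factor \<open>sin\<close> stays on the left, so nothing has to be divided yet.\<close>

lemma Digamma_reflection_complex:
  fixes z :: complex
  assumes "z \<notin> \<int>"
  shows "(Digamma (1 - z) - Digamma z) * sin (of_real pi * z) = of_real pi * cos (of_real pi * z)"
proof -
  have nz: "z \<notin> \<int>\<^sub>\<le>\<^sub>0"
    using assms nonpos_Ints_Int by blast
  have "1 - (1 - z) \<in> \<int>" if "1 - z \<in> \<int>"
    using that by (rule Ints_diff[OF Ints_1])
  then have nz': "1 - z \<notin> \<int>\<^sub>\<le>\<^sub>0"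
    using assms nonpos_Ints_Int[of "1 - z"] by auto
  have "((\<lambda>z. rGamma z * rGamma (1 - z)) has_field_derivative
      rGamma z * (- (- rGamma (1 - z) * Digamma (1 - z))) + (- rGamma z * Digamma z) * rGamma (1 - z)) (at z)"
    using nz nz' by (auto intro!: derivative_eq_intros)
  moreover have "((\<lambda>z. rGamma z * rGamma (1 - z)) has_field_derivative
      cos (of_real pi * z)) (at z)"
    unfolding rGamma_reflection_complex
    by (auto intro!: derivative_eq_intros)
  ultimately have "(rGamma z * rGamma (1 - z)) * (Digamma (1 - z) - Digamma z) = cos (of_real pi * z)"
    by (auto simp: algebra_simps dest: DERIV_unique)
  then show ?thesis
    by (simp add: rGamma_reflection_complex field_simps)
qed

text \<open>The Digamma series at \<open>1 - v\<close> and at \<open>v\<close> are subtracted, so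
  that the harmonic terms and Euler's constant cancel. The value comes from the complex reflection
  formula, restricted to real arguments.\<close>

lemma cot_partial_fractions:
  fixes v :: real
  assumes "v \<notin> \<int>"
  shows "(\<lambda>k. 1 / (real k + v) - 1 / (real k + 1 - v)) sums (pi * cos (pi * v) / sin (pi * v))"
proof -
  have v0: "v \<noteq> 0" "1 - v \<noteq> 0"
    using assms by auto
  have "complex_of_real v \<notin> \<int>"
    using assms by (simp add: of_real_in_Ints_iff)
  note refl = Digamma_reflection_complex[OF this]
  have "Digamma (1 - complex_of_real v) = of_real (Digamma (1 - v))"
    "Digamma (complex_of_real v) = of_real (Digamma v)"
    using v0 Polygamma_of_real[of "1 - v" 0, where 'a = complex]
      Polygamma_of_real[of v 0, where 'a = complex] by simp_all
  with refl
  have "complex_of_real ((Digamma (1 - v) - Digamma v) * sin (pi * v)) = of_real (pi * cos (pi * v))"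
    by (simp add: sin_of_real cos_of_real flip: of_real_mult of_real_diff)
  then have eq: "(Digamma (1 - v) - Digamma v) * sin (pi * v) = pi * cos (pi * v)"
    unfolding of_real_eq_iff .
  have "sin (pi * v) \<noteq> 0"
    using assms by (auto simp: sin_zero_iff_int2)
  then have eq': "Digamma (1 - v) - Digamma v = pi * cos (pi * v) / sin (pi * v)"
    using eq by (simp add: field_simps)
  have "(\<lambda>k. (inverse (real (Suc k)) - inverse (1 - v + real k)) - (inverse (real (Suc k)) - inverse (v + real k)))
      sums ((Digamma (1 - v) + euler_mascheroni) - (Digamma v + euler_mascheroni))"
    using summable_Digamma[OF v0(1)] summable_Digamma[OF v0(2)]
    by (intro sums_diff) (simp_all add: Digamma_def summable_sums)
  then show ?thesis
    by (simp add: eq' inverse_eq_divide algebra_simps)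
qed

text \<open>This is the cotangent expansion at \<open>v = (1 - x) / 2\<close>, where
  \<open>pi * v = pi / 2 - pi * x / 2\<close>. Integral \<open>v\<close> corresponds to odd
  \<open>x\<close>.\<close>

lemma tan_partial_fractions:
  fixes x :: real
  assumes "\<And>n::int. odd n \<Longrightarrow> x \<noteq> of_int n"
  shows "(\<lambda>k. x / ((2 * real k + 1)\<^sup>2 - x\<^sup>2)) sums (pi / 4 * tan (pi * x / 2))"
proof -
  have "(1 - x) / 2 \<notin> \<int>"
  proof
    assume "(1 - x) / 2 \<in> \<int>"
    then obtain n :: int where "(1 - x) / 2 = of_int n"
      by (auto elim: Ints_cases)
    then have "x = of_int (1 - 2 * n)"
      by (simp add: field_simps)
    then show False
      using assms[of "1 - 2 * n"] by simp
  qed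
  from sums_mult[OF cot_partial_fractions[OF this], of "1 / 4"]
  have "(\<lambda>k. 1 / 4 * (1 / (real k + (1 - x) / 2) - 1 / (real k + 1 - (1 - x) / 2))) sums
      (1 / 4 * (pi * cos (pi * ((1 - x) / 2)) / sin (pi * ((1 - x) / 2))))" .
  moreover have "pi * ((1 - x) / 2) = pi / 2 - pi * x / 2"
    by (simp add: field_simps)
  moreover have "1 / 4 * (1 / (real k + (1 - x) / 2) - 1 / (real k + 1 - (1 - x) / 2))
      = x / ((2 * real k + 1)\<^sup>2 - x\<^sup>2)" for k
  proof -
    have nz: "2 * real k + 1 - x \<noteq> 0" "2 * real k + 1 + x \<noteq> 0"
      using assms[of "2 * int k + 1"] assms[of "- (2 * int k + 1)"] by auto
    have "1 / (real k + (1 - x) / 2) = 2 / (2 * real k + 1 - x)"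
      "1 / (real k + 1 - (1 - x) / 2) = 2 / (2 * real k + 1 + x)"
      using nz by (simp_all add: field_simps)
    moreover have "(2 * real k + 1)\<^sup>2 - x\<^sup>2 = (2 * real k + 1 - x) * (2 * real k + 1 + x)"
      by (simp add: power2_eq_square algebra_simps)
    moreover have "1 / 4 * (2 / (a - x) - 2 / (a + x)) = x / ((a - x) * (a + x))"
      if "a - x \<noteq> 0" "a + x \<noteq> 0" for a
      using that by (simp add: divide_simps)
    ultimately show ?thesis
      using nz by simp
  qed
  moreover have "cos (pi / 2 - pi * x / 2) = sin (pi * x / 2)" "sin (pi / 2 - pi * x / 2) = cos (pi * x / 2)"
    by (simp_all only: cos_diff sin_diff) simp_all
  ultimately have "(\<lambda>k. x / ((2 * real k + 1)\<^sup>2 - x\<^sup>2)) sums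
      (1 / 4 * (pi * sin (pi * x / 2) / cos (pi * x / 2)))"
    by (simp only:)
  then show ?thesis
    by (simp add: tan_def)
qed

text \<open>Add the cotangent expansions at \<open>(1 + x) / 4\<close> and
  \<open>(1 - x) / 4\<close>. Their angles \<open>u\<close> and \<open>pi / 2 - u\<close> are
  complementary, and \<open>cot u + tan u = 2 / sin (2 * u) = 2 * sec (pi * x / 2)\<close>. The
  terms come out already paired by residues 1 and 3 modulo 4.\<close>

lemma sec_partial_fractions:
  fixes x :: real
  assumes "\<And>n::int. odd n \<Longrightarrow> x \<noteq> of_int n"
  shows "(\<lambda>k. (4 * real k + 1) / ((4 * real k + 1)\<^sup>2 - x\<^sup>2)
      - (4 * real k + 3) / ((4 * real k + 3)\<^sup>2 - x\<^sup>2)) sums (pi / 4 * sec (pi * x / 2))"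
proof -
  have notint: "(1 + y) / 4 \<notin> \<int>" if "y = x \<or> y = - x" for y
  proof
    assume "(1 + y) / 4 \<in> \<int>"
    then obtain n :: int where "(1 + y) / 4 = of_int n"
      by (auto elim: Ints_cases)
    then have "x = of_int (4 * n - 1) \<or> x = of_int (1 - 4 * n)"
      using that by (auto simp add: field_simps)
    then show False
      using assms[of "4 * n - 1"] assms[of "1 - 4 * n"] by auto
  qed
  define u where "u = pi * (1 + x) / 4"
  have u: "pi * ((1 + x) / 4) = u" "pi * ((1 + - x) / 4) = pi / 2 - u"
    by (simp_all add: u_def field_simps)
  have su: "sin u \<noteq> 0"
    using notint[of x] unfolding u[symmetric] by (auto simp: sin_zero_iff_int2)
  have cu: "cos u \<noteq> 0"
  proof -
    have "cos u = sin (pi * ((1 + - x) / 4))"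
      unfolding u(2) by (simp add: sin_diff)
    then show ?thesis
      using notint[of "-x"] by (auto simp: sin_zero_iff_int2)
  qed
  have "sec (pi * x / 2) = 1 / (2 * sin u * cos u)"
  proof -
    have "2 * u = pi / 2 + pi * x / 2"
      by (simp add: u_def field_simps)
    then have "cos (pi * x / 2) = sin (2 * u)"
      by (simp only: sin_add) simp
    then show ?thesis
      by (simp add: sec_def sin_double)
  qed
  also have "\<dots> = 1 / 2 * (cos u / sin u + sin u / cos u)"
    using su cu by (simp add: field_simps flip: power2_eq_square)
  finally have sec: "pi / 4 * sec (pi * x / 2) = 1 / 8 * (pi * cos u / sin u + pi * sin u / cos u)"
    by (simp add: algebra_simps)
  have "(\<lambda>k. 1 / 8 * ((1 / (real k + (1 + x) / 4) - 1 / (real k + 1 - (1 + x) / 4))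
      + (1 / (real k + (1 + - x) / 4) - 1 / (real k + 1 - (1 + - x) / 4)))) sums
      (1 / 8 * (pi * cos u / sin u + pi * sin u / cos u))"
    using sums_mult[OF sums_add[OF cot_partial_fractions[OF notint[of x]] cot_partial_fractions[OF notint[of "-x"]]], of "1 / 8"]
    unfolding u by (simp add: sin_diff cos_diff)
  moreover have "1 / 8 * ((1 / (real k + (1 + x) / 4) - 1 / (real k + 1 - (1 + x) / 4))
      + (1 / (real k + (1 + - x) / 4) - 1 / (real k + 1 - (1 + - x) / 4)))
    = (4 * real k + 1) / ((4 * real k + 1)\<^sup>2 - x\<^sup>2)
      - (4 * real k + 3) / ((4 * real k + 3)\<^sup>2 - x\<^sup>2)" for k
  proof -
    have nz: "4 * real k + 1 - x \<noteq> 0" "4 * real k + 1 + x \<noteq> 0" "4 * real k + 3 - x \<noteq> 0" "4 * real k + 3 + x \<noteq> 0"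
      using assms[of "4 * int k + 1"] assms[of "- (4 * int k + 1)"]
        assms[of "4 * int k + 3"] assms[of "- (4 * int k + 3)"] by auto
    have e: "1 / (real k + (1 + x) / 4) = 4 / (4 * real k + 1 + x)"
      "1 / (real k + 1 - (1 + x) / 4) = 4 / (4 * real k + 3 - x)"
      "1 / (real k + (1 + - x) / 4) = 4 / (4 * real k + 1 - x)"
      "1 / (real k + 1 - (1 + - x) / 4) = 4 / (4 * real k + 3 + x)"
      using nz by (simp_all add: field_simps)
    have g: "1 / 8 * (4 / (a + x) + 4 / (a - x)) = a / (a\<^sup>2 - x\<^sup>2)"
      if "a + x \<noteq> 0" "a - x \<noteq> 0" for a
    proof -
      have "a\<^sup>2 - x\<^sup>2 = (a - x) * (a + x)"
        by (simp add: power2_eq_square algebra_simps)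
      then show ?thesis
        using that by (simp add: divide_simps)
    qed
    show ?thesis
      unfolding e g[OF nz(2,1), symmetric] g[OF nz(4,3), symmetric] by argo
  qed
  ultimately show ?thesis
    unfolding sec by (simp only:)
qed

section \<open>Absolute convergence of the double series\<close>

lemma summable_on_Times_mult:
  fixes f :: "'a \<Rightarrow> real" and g :: "'b \<Rightarrow> real"
  assumes "f summable_on A" and "g summable_on B"
  shows "(\<lambda>(x, y). f x * g y) summable_on A \<times> B"
proof -
  have f: "(\<lambda>x. \<bar>f x\<bar>) summable_on A" and g: "(\<lambda>y. \<bar>g y\<bar>) summable_on B"
    using assms by (simp_all flip: real_norm_def summable_on_iff_abs_summable_on_real)
  have "(\<lambda>xy. norm ((\<lambda>(x, y). f x * g y) xy)) summable_on A \<times> B"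
    unfolding Infinite_Sum.abs_summable_on_Sigma_iff
  proof (intro conjI ballI)
    show "(\<lambda>y. norm (case (x, y) of (x, y) \<Rightarrow> f x * g y)) summable_on B" for x
      using summable_on_cmult_right[OF g, of "\<bar>f x\<bar>"] by (simp add: abs_mult)
    show "(\<lambda>x. norm (\<Sum>\<^sub>\<infinity>y\<in>B. norm (case (x, y) of (x, y) \<Rightarrow> f x * g y))) summable_on A"
      using summable_on_cmult_left[OF f, of "\<bar>\<Sum>\<^sub>\<infinity>y\<in>B. \<bar>g y\<bar>\<bar>"]
      by (simp add: abs_mult infsum_cmult_right')
  qed
  then show ?thesis
    by (rule Infinite_Sum.abs_summable_summable)
qed

text \<open>The usual bound \<open>c / m^2\<close> on the distance from \<open>x\<close> to
  \<open>n / m\<close> is multiplied by the size of \<open>m\<close>, because the double series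
  contains the factor \<open>n - m * x\<close>.\<close>

definition badly_approximable :: "real \<Rightarrow> bool" where
  "badly_approximable x \<longleftrightarrow>
     (\<exists>c>0. \<forall>m n :: int. m \<noteq> 0 \<longrightarrow> c / \<bar>of_int m\<bar> \<le> \<bar>of_int n - of_int m * x\<bar>)"

lemma badly_approximable_neq_0:
  assumes "badly_approximable x"
  shows "x \<noteq> 0"
proof
  assume "x = 0"
  then obtain c :: real where "c > 0"
    and c: "\<And>m n :: int. m \<noteq> 0 \<Longrightarrow> c / \<bar>of_int m\<bar> \<le> \<bar>of_int n - of_int m * 0 :: real\<bar>"
    using assms by (auto simp: badly_approximable_def)
  then show False
    using c[of 1 0] by simp
qed

lemma badly_approximable_add_int:
  assumes "badly_approximable x"
  shows "badly_approximable (x + of_int k)"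
proof -
  obtain c where "c > 0"
    and c: "\<And>m n :: int. m \<noteq> 0 \<Longrightarrow> c / \<bar>of_int m\<bar> \<le> \<bar>of_int n - of_int m * x\<bar>"
    using assms by (auto simp: badly_approximable_def)
  have "c / \<bar>of_int m\<bar> \<le> \<bar>of_int n - of_int m * (x + of_int k)\<bar>" if "m \<noteq> 0" for m n :: int
    using c[OF that, of "n - m * k"] by (simp add: algebra_simps)
  with \<open>c > 0\<close> show ?thesis
    unfolding badly_approximable_def by blast
qed

text \<open>The estimates below assume \<open>x > 0\<close>, but reciprocity is also applied at
  \<gamma>, which is negative for \<open>p < 0\<close>. The terms depend only on the square of
  \<open>x\<close>.\<close>

lemma badly_approximable_abs:
  assumes "badly_approximable x"
  shows "badly_approximable \<bar>x\<bar>"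
proof -
  obtain c where "c > 0"
    and c: "\<And>m n :: int. m \<noteq> 0 \<Longrightarrow> c / \<bar>of_int m\<bar> \<le> \<bar>of_int n - of_int m * x\<bar>"
    using assms by (auto simp: badly_approximable_def)
  have "c / \<bar>of_int m\<bar> \<le> \<bar>of_int n - of_int m * \<bar>x\<bar>\<bar>" if "m \<noteq> 0" for m n :: int
    using c[OF that, of n] c[of "-m" n] that by (cases "x \<ge> 0") simp_all
  with \<open>c > 0\<close> show ?thesis
    unfolding badly_approximable_def by blast
qed

text \<open>
  Sort the pairs of odd \<open>m\<close>, \<open>n\<close> by the dyadic size \<open>2\<^sup>-\<^sup>l\<close> of \<open>\<bar>n - m x\<bar>\<close>. Within one class, bad
  approximability of \<open>x\<close> forces the values \<open>m\<close> to be at distance at least \<open>c 2\<^sup>l / 2\<close> from each other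
  and from 0, so \<open>m\<close> is determined by \<open>w = \<lfloor>2 m / (c 2\<^sup>l)\<rfloor> \<ge> 1\<close> and the terms are
  \<open>O(2\<^sup>-\<^sup>l / w\<^sup>2)\<close>.
\<close>

lemma summable_on_near_diagonal:
  fixes x :: real
  assumes "badly_approximable x" and "x > 0"
  shows "(\<lambda>(i, j). 1 / ((2 * real i + 1) * \<bar>(2 * real j + 1)\<^sup>2 - ((2 * real i + 1) * x)\<^sup>2\<bar>))
    summable_on {(i, j). \<bar>(2 * real j + 1) - (2 * real i + 1) * x\<bar> < 1}"
    (is "?t summable_on ?N")
proof -
  obtain c where "c > 0"
    and c: "\<And>m n :: int. m \<noteq> 0 \<Longrightarrow> c / \<bar>of_int m\<bar> \<le> \<bar>of_int n - of_int m * x\<bar>"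
    using assms by (auto simp: badly_approximable_def)
  define m where "m = (\<lambda>ij :: nat \<times> nat. 2 * int (fst ij) + 1)"
  define n where "n = (\<lambda>ij :: nat \<times> nat. 2 * int (snd ij) + 1)"
  define d where "d = (\<lambda>ij. \<bar>of_int (n ij) - of_int (m ij) * x\<bar>)"
  have m1: "real_of_int (m ij) \<ge> 1" and n1: "real_of_int (n ij) \<ge> 1" for ij
    by (simp_all add: m_def n_def)
  have d_lower: "d ij \<ge> c / of_int (m ij)" for ij
    using c[of "m ij" "n ij"] m1[of ij] by (simp add: d_def)
  have d_pos: "d ij > 0" for ij
    using d_lower[of ij] \<open>c > 0\<close> m1[of ij] by (smt (verit) divide_pos_pos)
  have N: "?N = {ij. d ij < 1}"
    by (auto simp: d_def m_def n_def)
  \<comment> \<open>The least \<open>k\<close> with \<open>1 / 2 ^ k \<le> d ij\<close> is positive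
    because \<open>d ij < 1\<close>; its predecessor is \<open>l\<close>.\<close>
  have "\<exists>l::nat. 1 / 2 ^ (l + 1) \<le> d ij \<and> d ij < 1 / 2 ^ l" if "d ij < 1" for ij
  proof -
    obtain k where "(1 / 2) ^ k < d ij"
      using real_arch_pow_inv[OF d_pos, of "1/2" ij] by auto
    then have ex: "1 / 2 ^ k \<le> d ij"
      by (simp add: power_divide)
    define k0 where "k0 = (LEAST k. 1 / 2 ^ k \<le> d ij)"
    have k0: "1 / 2 ^ k0 \<le> d ij"
      unfolding k0_def by (rule LeastI[of "\<lambda>k. 1 / 2 ^ k \<le> d ij", OF ex])
    with that obtain l where l: "k0 = Suc l"
      by (cases k0) auto
    have "\<not> 1 / 2 ^ l \<le> d ij"
      using not_less_Least[of l "\<lambda>k. 1 / 2 ^ k \<le> d ij"] l by (simp add: k0_def)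
    then show ?thesis
      using k0 l by (intro exI[of _ l]) auto
  qed
  then obtain l :: "nat \<times> nat \<Rightarrow> nat"
    where l: "\<And>ij. d ij < 1 \<Longrightarrow> 1 / 2 ^ (l ij + 1) \<le> d ij"
      "\<And>ij. d ij < 1 \<Longrightarrow> d ij < 1 / 2 ^ l ij"
    by metis
  define w where "w = (\<lambda>ij. nat \<lfloor>2 * of_int (m ij) / (c * 2 ^ l ij)\<rfloor>)"
  have w_le: "real (w ij) \<le> 2 * of_int (m ij) / (c * 2 ^ l ij)" for ij
    unfolding w_def using \<open>c > 0\<close> m1[of ij] by (intro of_nat_floor) simp
  \<comment> \<open>Here \<open>c / m \<le> d < 1 / 2 ^ l\<close> gives
    \<open>m > c * 2 ^ l\<close>. The value \<open>w = 0\<close> must be excluded, since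
    \<open>1 / 0\<close> is 0 and the majorant would vanish there.\<close>
  have w_ge: "w ij \<ge> 1" if "d ij < 1" for ij
  proof -
    have "c / of_int (m ij) < 1 / 2 ^ l ij"
      using d_lower[of ij] l(2)[OF that] by linarith
    then have "c * 2 ^ l ij < of_int (m ij)"
      using m1[of ij] by (simp add: field_simps)
    then have "1 \<le> 2 * of_int (m ij) / (c * 2 ^ l ij)"
      using \<open>c > 0\<close> m1[of ij] by (simp add: field_simps)
    then show ?thesis
      unfolding w_def by linarith
  qed
  have inj: "inj_on (\<lambda>ij. (l ij, w ij)) {ij. d ij < 1}"
  proof (rule inj_onI)
    fix a b
    assume a: "a \<in> {ij. d ij < 1}" and b: "b \<in> {ij. d ij < 1}" and eq: "(l a, w a) = (l b, w b)"
    have lb: "l b = l a"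
      using eq by simp
    have da: "d a < 1 / 2 ^ l a" and db: "d b < 1 / 2 ^ l a"
      using l(2)[of a] l(2)[of b] a b lb by auto
    \<comment> \<open>Bad approximability is applied to the difference of two pairs in one class:
      distinct \<open>m\<close> would be more than \<open>c * 2 ^ l / 2\<close> apart, but equal
      \<open>w\<close> puts them closer than that.\<close>
    have diff: "\<bar>of_int (n a - n b) - of_int (m a - m b) * x\<bar> < 2 / 2 ^ l a"
      using da db unfolding d_def by (auto simp: algebra_simps)
    have "m a = m b"
    proof (rule ccontr)
      assume ne: "m a \<noteq> m b"
      then have "c / \<bar>of_int (m a - m b)\<bar> < 2 / 2 ^ l a"
        using c[of "m a - m b" "n a - n b"] diff by simp
      then have 1: "c * 2 ^ l a < 2 * \<bar>of_int (m a - m b)\<bar>"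
        using ne by (simp add: field_simps)
      have "\<lfloor>2 * of_int (m a) / (c * 2 ^ l a)\<rfloor> = \<lfloor>2 * of_int (m b) / (c * 2 ^ l a)\<rfloor>"
      proof -
        have "nat \<lfloor>2 * of_int (m a) / (c * 2 ^ l a)\<rfloor> = nat \<lfloor>2 * of_int (m b) / (c * 2 ^ l a)\<rfloor>"
          using eq lb by (simp add: w_def)
        moreover have "\<lfloor>2 * of_int (m ij) / (c * 2 ^ l a)\<rfloor> \<ge> 0" for ij
          using \<open>c > 0\<close> m1[of ij] by simp
        ultimately show ?thesis
          by (simp add: eq_nat_nat_iff)
      qed
      then have "\<bar>2 * of_int (m a) / (c * 2 ^ l a) - 2 * of_int (m b) / (c * 2 ^ l a)\<bar> < 1"
        by linarith
      then have "\<bar>2 * of_int (m a - m b) / (c * 2 ^ l a)\<bar> < 1"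
        by (simp add: diff_divide_distrib right_diff_distrib)
      then have "2 * \<bar>of_int (m a - m b)\<bar> < c * 2 ^ l a"
        using \<open>c > 0\<close> by (simp only: abs_divide abs_mult) (simp add: field_simps)
      with 1 show False
        by linarith
    qed
    \<comment> \<open>With equal \<open>m\<close>, the two odd numbers \<open>n\<close> differ by
      less than 2.\<close>
    moreover have "n a = n b"
    proof -
      have "2 / 2 ^ l a \<le> (2::real)"
        by (simp add: field_simps)
      then have "real_of_int \<bar>n a - n b\<bar> < real_of_int 2"
        using diff \<open>m a = m b\<close> by simp
      then have "\<bar>n a - n b\<bar> < 2"
        by (simp only: of_int_less_iff)
      then show ?thesis
        unfolding n_def by presburger
    qed
    ultimately show "a = b"
      by (simp add: m_def n_def prod_eq_iff)
  qed
  let ?G = "\<lambda>(l::nat, w::nat). (1 / 2) ^ l * (1 / real w ^ 2)"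
  have "?G summable_on UNIV \<times> UNIV"
  proof (rule summable_on_Times_mult)
    show "(\<lambda>l. (1 / 2 :: real) ^ l) summable_on UNIV"
      by (intro summable_nonneg_imp_summable_on summable_geometric) auto
    show "(\<lambda>w. 1 / real w ^ 2) summable_on UNIV"
      using inverse_power_summable[of 2, where 'a = real]
      by (intro summable_nonneg_imp_summable_on) (auto simp: field_simps)
  qed
  then have "?G summable_on (\<lambda>ij. (l ij, w ij)) ` {ij. d ij < 1}"
    by (rule summable_on_subset) auto
  \<comment> \<open>The constant combines \<open>d \<ge> 1 / 2 ^ (l + 1)\<close>,
    \<open>n + m * x \<ge> m * x\<close> and \<open>m \<ge> w * c * 2 ^ l / 2\<close>.\<close>
  then have G: "(\<lambda>ij. 8 / (x * c\<^sup>2) * (?G \<circ> (\<lambda>ij. (l ij, w ij))) ij) summable_on {ij. d ij < 1}"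
    by (intro summable_on_cmult_right) (simp only: summable_on_reindex[OF inj])
  show ?thesis
    unfolding N
  proof (rule summable_on_comparison_test[OF G])
    fix ij
    assume "ij \<in> {ij. d ij < 1}"
    then have ij: "d ij < 1"
      by simp
    let ?m = "real_of_int (m ij)" and ?n = "real_of_int (n ij)" and ?w = "real (w ij)"
    have w: "?w \<ge> 1"
      using w_ge[OF ij] by simp
    have "?t ij = 1 / (?m * \<bar>?n\<^sup>2 - (?m * x)\<^sup>2\<bar>)"
      by (simp add: m_def n_def case_prod_beta)
    also have "?n\<^sup>2 - (?m * x)\<^sup>2 = (?n - ?m * x) * (?n + ?m * x)"
      by (simp add: power2_eq_square algebra_simps)
    also have "\<bar>\<dots>\<bar> = d ij * (?n + ?m * x)"
      using m1[of ij] n1[of ij] \<open>x > 0\<close> by (simp add: d_def abs_mult)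
    also have "1 / (?m * (d ij * (?n + ?m * x))) \<le> 1 / (?m * (1 / 2 ^ (l ij + 1) * (?m * x)))"
      using m1[of ij] n1[of ij] \<open>x > 0\<close> l(1)[OF ij] d_pos[of ij]
      by (intro divide_left_mono mult_left_mono mult_mono mult_pos_pos add_pos_pos) auto
    also have "\<dots> = 2 * 2 ^ l ij / x * (1 / ?m\<^sup>2)"
      by (simp add: power2_eq_square field_simps)
    also have "\<dots> \<le> 2 * 2 ^ l ij / x * (1 / (?w * (c * 2 ^ l ij) / 2)\<^sup>2)"
    proof (intro mult_left_mono divide_left_mono power_mono mult_pos_pos)
      show "?w * (c * 2 ^ l ij) / 2 \<le> ?m"
        using w_le[of ij] \<open>c > 0\<close> by (simp add: field_simps)
    qed (use m1[of ij] w \<open>c > 0\<close> \<open>x > 0\<close> in auto)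
    also have "\<dots> = 8 / (x * c\<^sup>2) * (?G \<circ> (\<lambda>ij. (l ij, w ij))) ij"
      using w \<open>c > 0\<close> \<open>x > 0\<close> by (simp add: field_simps power2_eq_square)
    finally show "?t ij \<le> 8 / (x * c\<^sup>2) * (?G \<circ> (\<lambda>ij. (l ij, w ij))) ij" .
    show "0 \<le> ?t ij"
      by (simp add: case_prod_beta)
  qed
qed

text \<open>
  With \<open>d = \<bar>n - m x\<bar>\<close>, the inequality \<open>(n + m x)\<^sup>2 \<ge> m x d\<close> bounds the terms by a multiple of
  \<open>m\<^sup>-\<^sup>3\<^sup>/\<^sup>2 d\<^sup>-\<^sup>3\<^sup>/\<^sup>2\<close>, which is summable over \<open>m\<close> and \<open>\<lfloor>n - m x\<rfloor>\<close>.
\<close>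

lemma summable_on_off_diagonal:
  fixes x :: real
  assumes "x > 0"
  shows "(\<lambda>(i, j). 1 / ((2 * real i + 1) * \<bar>(2 * real j + 1)\<^sup>2 - ((2 * real i + 1) * x)\<^sup>2\<bar>))
    summable_on {(i, j). 1 \<le> \<bar>(2 * real j + 1) - (2 * real i + 1) * x\<bar>}"
    (is "?t summable_on ?F")
proof -
  let ?e = "- (3 / 2) :: real"
  define h where "h = (\<lambda>(i::nat, j::nat). (i, \<lfloor>(2 * real j + 1) - (2 * real i + 1) * x\<rfloor>))"
  \<comment> \<open>For fixed \<open>i\<close> the numbers \<open>2 * j + 1\<close> are two apart,
    so the floors separate them.\<close>
  have inj: "inj_on h ?F"
  proof (rule inj_onI)
    fix a b assume "h a = h b"
    then show "a = b"
      by (cases a; cases b) (auto simp: h_def, linarith)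
  qed
  have p: "(\<lambda>i::nat. (real i + 1) powr ?e) summable_on UNIV"
  proof -
    have "summable (\<lambda>i. real (Suc i) powr ?e)"
      by (subst summable_Suc_iff) (simp add: summable_real_powr_iff)
    then show ?thesis
      by (intro summable_nonneg_imp_summable_on) (simp_all add: add.commute)
  qed
  have "(\<lambda>k::int. (\<bar>of_int k\<bar> + 1) powr ?e) summable_on range int \<union> range (\<lambda>i. - int i)"
  proof (rule summable_on_union)
    show "(\<lambda>k::int. (\<bar>of_int k\<bar> + 1) powr ?e) summable_on range int"
      by (subst summable_on_reindex) (use p in \<open>auto simp: inj_on_def o_def\<close>)
    show "(\<lambda>k::int. (\<bar>of_int k\<bar> + 1) powr ?e) summable_on range (\<lambda>i. - int i)"
      by (subst summable_on_reindex) (use p in \<open>auto simp: inj_on_def o_def\<close>)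
  qed
  moreover have "range int \<union> range (\<lambda>i. - int i) = UNIV"
    by (auto simp: image_iff) (metis int_cases2)
  ultimately have "(\<lambda>k::int. (\<bar>of_int k\<bar> + 1) powr ?e) summable_on UNIV"
    by simp
  from summable_on_Times_mult[OF p this]
  have "(\<lambda>(i, k). (real i + 1) powr ?e * (\<bar>of_int k\<bar> + 1) powr ?e) summable_on h ` ?F"
    by (rule summable_on_subset) auto
  then have G: "(\<lambda>ij. (x powr - (1 / 2) * (1 / 3) powr ?e) *
      ((\<lambda>(i, k). (real i + 1) powr ?e * (\<bar>of_int k\<bar> + 1) powr ?e) \<circ> h) ij) summable_on ?F"
    by (intro summable_on_cmult_right) (simp only: summable_on_reindex[OF inj])
  show ?thesis
  proof (rule summable_on_comparison_test[OF G])
    fix ij assume "ij \<in> ?F"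
    then obtain i j where ij: "ij = (i, j)" and far: "1 \<le> \<bar>(2 * real j + 1) - (2 * real i + 1) * x\<bar>"
      by auto
    define m where "m = 2 * real i + 1"
    define n where "n = 2 * real j + 1"
    define d where "d = \<bar>n - m * x\<bar>"
    define k where "k = \<lfloor>n - m * x\<rfloor>"
    have m1: "m \<ge> 1" and n1: "n \<ge> 1"
      by (simp_all add: m_def n_def)
    have mx: "m * x > 0"
      using m1 \<open>x > 0\<close> by simp
    have d1: "d \<ge> 1"
      using far by (simp add: d_def m_def n_def)
    \<comment> \<open>The size of \<open>k\<close> is at most \<open>d + 1\<close>, and
      \<open>d + 2 \<le> 3 * d\<close> because \<open>d \<ge> 1\<close>.\<close>
    have "d \<ge> (\<bar>of_int k\<bar> + 1) / 3"
    proof -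
      have "of_int k \<le> n - m * x" "n - m * x < of_int k + 1"
        by (simp_all add: k_def)
      with d1 show ?thesis
        unfolding d_def by (simp add: abs_if split: if_splits)
    qed
    then have dk: "d powr ?e \<le> ((\<bar>of_int k\<bar> + 1) / 3) powr ?e"
      by (intro powr_mono2') auto
    have "m * x * d \<le> (n + m * x) * (n + m * x)"
      using mx n1 by (intro mult_mono) (auto simp: d_def)
    then have sq: "(m * x * d) powr (1 / 2) \<le> n + m * x"
      using mx n1 d1 by (simp add: powr_half_sqrt real_le_lsqrt power2_eq_square)
    have "?t ij = 1 / (m * \<bar>n\<^sup>2 - (m * x)\<^sup>2\<bar>)"
      by (simp add: m_def n_def ij)
    also have "n\<^sup>2 - (m * x)\<^sup>2 = (n - m * x) * (n + m * x)"
      by (simp add: power2_eq_square algebra_simps)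
    also have "\<bar>\<dots>\<bar> = d * (n + m * x)"
      using mx n1 by (simp add: d_def abs_mult)
    also have "1 / (m * (d * (n + m * x))) \<le> 1 / (m * (d * (m * x * d) powr (1 / 2)))"
      using m1 d1 n1 mx sq by (intro divide_left_mono mult_left_mono mult_pos_pos) auto
    also have "\<dots> = x powr - (1 / 2) * (m powr ?e * d powr ?e)"
    proof -
      have "y powr ?e = 1 / (y * y powr (1 / 2))" if "y > 0" for y :: real
        using that powr_add[of y 1 "1/2"] by (simp add: powr_minus_divide)
      then show ?thesis
        using m1 d1 \<open>x > 0\<close> by (simp add: powr_mult powr_minus_divide)
    qed
    also have "\<dots> \<le> x powr - (1 / 2) * ((real i + 1) powr ?e * ((\<bar>of_int k\<bar> + 1) / 3) powr ?e)"
    proof (intro mult_left_mono mult_mono dk)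
      show "m powr ?e \<le> (real i + 1) powr ?e"
        by (intro powr_mono2') (simp_all add: m_def)
    qed simp_all
    also have "\<dots> = (x powr - (1 / 2) * (1 / 3) powr ?e) *
      ((\<lambda>(i, k). (real i + 1) powr ?e * (\<bar>of_int k\<bar> + 1) powr ?e) \<circ> h) ij"
      using powr_mult[of "\<bar>of_int k\<bar> + 1" "1 / 3" ?e] by (simp add: ij h_def k_def m_def n_def)
    finally show "?t ij \<le> (x powr - (1 / 2) * (1 / 3) powr ?e) *
      ((\<lambda>(i, k). (real i + 1) powr ?e * (\<bar>of_int k\<bar> + 1) powr ?e) \<circ> h) ij" .
    show "0 \<le> ?t ij"
      by (simp add: case_prod_beta)
  qed
qed

lemma summable_on_odd_pairs:
  fixes x :: real
  assumes "badly_approximable x"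
  shows "(\<lambda>(i, j). 1 / ((2 * real i + 1) * \<bar>(2 * real j + 1)\<^sup>2 - ((2 * real i + 1) * x)\<^sup>2\<bar>))
    summable_on UNIV \<times> UNIV"
proof -
  have x: "\<bar>x\<bar> > 0"
    using badly_approximable_neq_0[OF assms] by simp
  have "(\<lambda>(i, j). 1 / ((2 * real i + 1) * \<bar>(2 * real j + 1)\<^sup>2 - ((2 * real i + 1) * \<bar>x\<bar>)\<^sup>2\<bar>))
    summable_on {(i, j). \<bar>(2 * real j + 1) - (2 * real i + 1) * \<bar>x\<bar>\<bar> < 1}
      \<union> {(i, j). 1 \<le> \<bar>(2 * real j + 1) - (2 * real i + 1) * \<bar>x\<bar>\<bar>}"
    by (rule summable_on_union[OF summable_on_near_diagonal[OF badly_approximable_abs[OF assms] x]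
          summable_on_off_diagonal[OF x]])
  moreover have "{(i, j). \<bar>(2 * real j + 1) - (2 * real i + 1) * \<bar>x\<bar>\<bar> < 1}
      \<union> {(i, j). 1 \<le> \<bar>(2 * real j + 1) - (2 * real i + 1) * \<bar>x\<bar>\<bar>} = UNIV \<times> UNIV"
    by auto
  ultimately show ?thesis
    by (simp add: power_mult_distrib)
qed

section \<open>Reciprocity and periodicity\<close>

text \<open>Index \<open>i\<close> stands for the odd number \<open>m = 2 * i + 1\<close>, and the
  sign is the value of the character modulo 4 at \<open>m\<close>.\<close>

definition tan_term :: "real \<Rightarrow> nat \<Rightarrow> real" where
  "tan_term x i = (- 1) ^ i * tan ((2 * real i + 1) * pi * x / 2) / (2 * real i + 1)\<^sup>2"

text \<open>The even squares contribute a quarter of \<open>pi^2 / 6\<close>; the rest is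
  \<open>pi^2 / 8\<close>.\<close>

lemma inverse_odd_squares_sums: "(\<lambda>k. 1 / (2 * real k + 1)\<^sup>2) sums (pi\<^sup>2 / 8)"
proof -
  have "(\<lambda>k. \<Sum>i\<in>{k * 2..<k * 2 + 2}. 1 / (real i + 1)\<^sup>2) sums (pi\<^sup>2 / 6)"
    by (rule sums_group) (use inverse_squares_sums in \<open>simp_all add: add_ac\<close>)
  moreover have "(\<Sum>i\<in>{k * 2..<k * 2 + 2}. 1 / (real i + 1)\<^sup>2)
      = 1 / (2 * real k + 1)\<^sup>2 + 1 / (2 * real k + 2)\<^sup>2" for k
    by (simp add: numeral_2_eq_2 algebra_simps)
  moreover have "(\<lambda>k. 1 / (2 * real k + 2)\<^sup>2) sums (pi\<^sup>2 / 24)"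
  proof -
    have "1 / (2 * real k + 2)\<^sup>2 = 1 / 4 * (1 / (real k + 1)\<^sup>2)" for k
      by (simp add: field_simps power2_eq_square)
    then show ?thesis
      using sums_mult[OF inverse_squares_sums, of "1 / 4"] by (simp add: add_ac)
  qed
  ultimately have "(\<lambda>k. (1 / (2 * real k + 1)\<^sup>2 + 1 / (2 * real k + 2)\<^sup>2) - 1 / (2 * real k + 2)\<^sup>2)
      sums (pi\<^sup>2 / 6 - pi\<^sup>2 / 24)"
    by (intro sums_diff) simp_all
  then show ?thesis
    by simp
qed

lemma badly_approximable_neq_of_int:
  assumes "badly_approximable x" and "m \<noteq> 0"
  shows "of_int m * x \<noteq> of_int n"
proof
  assume eq: "of_int m * x = of_int n"
  obtain c where "c > 0" "c / \<bar>of_int m\<bar> \<le> \<bar>of_int n - of_int m * x\<bar>"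
    using assms by (auto simp: badly_approximable_def)
  moreover have "c / \<bar>of_int m\<bar> > 0"
    using \<open>c > 0\<close> \<open>m \<noteq> 0\<close> by simp
  ultimately show False
    using eq by simp
qed

text \<open>Unconditional convergence will come from the absolute estimates and the value from the
  ordered partial fraction series.\<close>

lemma summable_on_sums_imp_has_sum:
  fixes f :: "nat \<Rightarrow> real"
  assumes "f summable_on UNIV" and "f sums s"
  shows "(f has_sum s) UNIV"
  using has_sum_infsum[OF assms(1)]
    sums_unique2[OF has_sum_imp_sums[OF has_sum_infsum[OF assms(1)]] assms(2)] by simp

text \<open>Both orders of summation of the family \<open>a\<close> give the same value
  \<open>A\<close>: summing over \<open>j\<close> first produces the tangent series, so that
  \<open>T = 4 * x / pi * A\<close>, and summing over \<open>i\<close> first produces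
  \<open>1 / n^2\<close> minus the secant terms. Using \<open>sums\<close> records convergence
  together with the value.\<close>

lemma secant_tangent_reciprocity:
  assumes "badly_approximable x"
  obtains T where "tan_term x sums T" and "f_term (1 / x / 2) sums (pi\<^sup>2 / 8 - T / x)"
proof -
  have x0: "x \<noteq> 0"
    using assms by (rule badly_approximable_neq_0)
  define a where "a = (\<lambda>(i::nat, j::nat). (- 1) ^ i /
      ((2 * real i + 1) * ((2 * real j + 1)\<^sup>2 - ((2 * real i + 1) * x)\<^sup>2)))"
  have "norm (a ij) = (\<lambda>(i, j). 1 / ((2 * real i + 1) *
      \<bar>(2 * real j + 1)\<^sup>2 - ((2 * real i + 1) * x)\<^sup>2\<bar>)) ij" for ij
    by (simp add: a_def case_prod_beta abs_mult power_abs)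
  then have "(\<lambda>ij. norm (a ij)) summable_on UNIV \<times> UNIV"
    using summable_on_odd_pairs[OF assms] by simp
  then have a_sum: "a summable_on UNIV \<times> UNIV"
    by (rule Infinite_Sum.abs_summable_summable)
  then have a_sum': "(\<lambda>(j, i). a (i, j)) summable_on UNIV \<times> UNIV"
    by (rule summable_on_swap[THEN iffD1])
  have row: "((\<lambda>j. a (i, j)) has_sum (pi / 4 * (tan_term x i / x))) UNIV" for i
  proof (rule summable_on_sums_imp_has_sum)
    show "(\<lambda>j. a (i, j)) summable_on UNIV"
      using summable_on_SigmaD1[of "\<lambda>i j. a (i, j)" UNIV "\<lambda>_. UNIV" i] a_sum by simp
    define X where "X = (2 * real i + 1) * x"
    have X0: "X \<noteq> 0"
      using x0 by (auto simp: X_def)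
    have "X \<noteq> of_int n" for n
      using badly_approximable_neq_of_int[OF assms, of "2 * int i + 1" n] by (simp add: X_def)
    then have "(\<lambda>k. X / ((2 * real k + 1)\<^sup>2 - X\<^sup>2)) sums (pi / 4 * tan (pi * X / 2))"
      by (intro tan_partial_fractions)
    then have "(\<lambda>k. (- 1) ^ i / ((2 * real i + 1) * X) * (X / ((2 * real k + 1)\<^sup>2 - X\<^sup>2)))
        sums ((- 1) ^ i / ((2 * real i + 1) * X) * (pi / 4 * tan (pi * X / 2)))"
      by (rule sums_mult)
    moreover have "(- 1) ^ i / ((2 * real i + 1) * X) * (X / ((2 * real k + 1)\<^sup>2 - X\<^sup>2)) = a (i, k)" for k
      using X0 by (simp add: a_def X_def)
    moreover have "(- 1) ^ i / ((2 * real i + 1) * X) * (pi / 4 * tan (pi * X / 2))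
        = pi / 4 * (tan_term x i / x)"
      by (simp add: tan_term_def X_def power2_eq_square mult_ac)
    ultimately show "(\<lambda>j. a (i, j)) sums (pi / 4 * (tan_term x i / x))"
      by (simp only:)
  qed
  have col: "((\<lambda>i. a (i, j)) has_sum (pi / 4 * (1 / (2 * real j + 1)\<^sup>2 - f_term (1 / x / 2) j))) UNIV" for j
  proof -
    have "(\<lambda>i. a (i, j)) summable_on UNIV"
      using summable_on_SigmaD1[of "\<lambda>j i. a (i, j)" UNIV "\<lambda>_. UNIV" j] a_sum' by simp
    then obtain s where s: "((\<lambda>i. a (i, j)) has_sum s) UNIV"
      by (auto simp: summable_on_def)
    define n where "n = 2 * real j + 1"
    define X where "X = n / x"
    have n0: "n \<noteq> 0"
      by (simp add: n_def)
    have Xne: "X \<noteq> of_int m" if "odd m" for m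
    proof -
      have "of_int m * x \<noteq> of_int (2 * int j + 1)"
        using that by (intro badly_approximable_neq_of_int[OF assms]) auto
      then show ?thesis
        using x0 by (auto simp: X_def n_def field_simps)
    qed
    have "(\<lambda>k. (4 * real k + 1) / ((4 * real k + 1)\<^sup>2 - X\<^sup>2)
      - (4 * real k + 3) / ((4 * real k + 3)\<^sup>2 - X\<^sup>2)) sums (pi / 4 * sec (pi * X / 2))"
      using Xne by (intro sec_partial_fractions)
    \<comment> \<open>Since \<open>n^2 / (m * (n^2 - (m * x)^2)) = 1 / m - m / (m^2 - X^2)\<close>,
      a column is a difference of two secant expansions. The one at 0 is Leibniz' series for
      \<open>pi / 4\<close>.\<close>
    moreover have "(\<lambda>k. (4 * real k + 1) / ((4 * real k + 1)\<^sup>2 - 0\<^sup>2)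
      - (4 * real k + 3) / ((4 * real k + 3)\<^sup>2 - 0\<^sup>2)) sums (pi / 4 * sec (pi * 0 / 2))"
      by (intro sec_partial_fractions) auto
    ultimately have "(\<lambda>k. 1 / n\<^sup>2 * (((4 * real k + 1) / ((4 * real k + 1)\<^sup>2 - 0\<^sup>2)
          - (4 * real k + 3) / ((4 * real k + 3)\<^sup>2 - 0\<^sup>2))
        - ((4 * real k + 1) / ((4 * real k + 1)\<^sup>2 - X\<^sup>2)
          - (4 * real k + 3) / ((4 * real k + 3)\<^sup>2 - X\<^sup>2))))
      sums (1 / n\<^sup>2 * (pi / 4 * sec (pi * 0 / 2) - pi / 4 * sec (pi * X / 2)))"
      by (intro sums_mult sums_diff)
    moreover have "1 / n\<^sup>2 * (((4 * real k + 1) / ((4 * real k + 1)\<^sup>2 - 0\<^sup>2)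
          - (4 * real k + 3) / ((4 * real k + 3)\<^sup>2 - 0\<^sup>2))
        - ((4 * real k + 1) / ((4 * real k + 1)\<^sup>2 - X\<^sup>2)
          - (4 * real k + 3) / ((4 * real k + 3)\<^sup>2 - X\<^sup>2)))
      = (\<Sum>i\<in>{k * 2..<k * 2 + 2}. a (i, j))" for k
    proof -
      have g: "1 / n\<^sup>2 * (m / (m\<^sup>2 - 0\<^sup>2) - m / (m\<^sup>2 - X\<^sup>2)) = 1 / (m * (n\<^sup>2 - (m * x)\<^sup>2))"
        if "m \<noteq> 0" "m\<^sup>2 \<noteq> X\<^sup>2" for m
      proof -
        have "m\<^sup>2 - X\<^sup>2 = - (n\<^sup>2 - (m * x)\<^sup>2) / x\<^sup>2"
          using x0 by (simp add: X_def field_simps)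
        moreover define E where "E = n\<^sup>2 - (m * x)\<^sup>2"
        ultimately have E: "m\<^sup>2 - X\<^sup>2 = - E / x\<^sup>2" "E \<noteq> 0"
          using that by auto
        have "m / (m\<^sup>2 - 0\<^sup>2) - m / (m\<^sup>2 - X\<^sup>2) = 1 / m + m * x\<^sup>2 / E"
          unfolding E(1) using that by (simp add: power2_eq_square)
        also have "\<dots> = (E + (m * x)\<^sup>2) / (m * E)"
          using E(2) that by (simp add: field_simps power2_eq_square)
        also have "E + (m * x)\<^sup>2 = n\<^sup>2"
          by (simp add: E_def)
        finally show ?thesis
          using n0 by (simp add: E_def)
      qed
      have ne: "(of_int m)\<^sup>2 \<noteq> X\<^sup>2" if "odd m" for m :: int
        using Xne[OF that] Xne[of "-m"] that by (auto simp: power2_eq_iff)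
      have odd: "2 * real (2 * k) + 1 = 4 * real k + 1" "2 * real (2 * k + 1) + 1 = 4 * real k + 3"
        by simp_all
      have "(\<Sum>i\<in>{k * 2..<k * 2 + 2}. a (i, j)) = a (2 * k, j) + a (2 * k + 1, j)"
        by (simp add: numeral_2_eq_2 mult.commute)
      also have "\<dots> = 1 / ((4 * real k + 1) * (n\<^sup>2 - ((4 * real k + 1) * x)\<^sup>2))
          - 1 / ((4 * real k + 3) * (n\<^sup>2 - ((4 * real k + 3) * x)\<^sup>2))"
        unfolding a_def prod.case odd n_def by simp
      also have "\<dots> = 1 / n\<^sup>2 * ((4 * real k + 1) / ((4 * real k + 1)\<^sup>2 - 0\<^sup>2)
            - (4 * real k + 1) / ((4 * real k + 1)\<^sup>2 - X\<^sup>2))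
          - 1 / n\<^sup>2 * ((4 * real k + 3) / ((4 * real k + 3)\<^sup>2 - 0\<^sup>2)
            - (4 * real k + 3) / ((4 * real k + 3)\<^sup>2 - X\<^sup>2))"
        using ne[of "4 * int k + 1"] ne[of "4 * int k + 3"]
        by (subst (1 2) g) simp_all
      finally show ?thesis
        by (simp add: right_diff_distrib)
    qed
    ultimately have "(\<lambda>k. \<Sum>i\<in>{k * 2..<k * 2 + 2}. a (i, j))
        sums (1 / n\<^sup>2 * (pi / 4 * sec (pi * 0 / 2) - pi / 4 * sec (pi * X / 2)))"
      by (simp only:)
    \<comment> \<open>The column is already known to have the sum \<open>s\<close>, so pairing
      \<open>m = 4 * k + 1\<close> with \<open>m = 4 * k + 3\<close> does not change it.\<close>
    moreover have "(\<lambda>k. \<Sum>i\<in>{k * 2..<k * 2 + 2}. a (i, j)) sums s"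
      using has_sum_imp_sums[OF s] by (rule sums_group) simp
    ultimately have "s = 1 / n\<^sup>2 * (pi / 4 * sec (pi * 0 / 2) - pi / 4 * sec (pi * X / 2))"
      by (rule sums_unique2[symmetric])
    also have "\<dots> = pi / 4 * (1 / n\<^sup>2 - f_term (1 / x / 2) j)"
    proof -
      have "pi * X / 2 = n * pi * (1 / x / 2)"
        by (simp add: X_def)
      then have "f_term (1 / x / 2) j = sec (pi * X / 2) / n\<^sup>2"
        by (simp only: f_term_def n_def)
      then show ?thesis
        by (simp add: sec_def[of 0] right_diff_distrib)
    qed
    finally show ?thesis
      using s by (simp only: n_def)
  qed
  obtain A where A: "(a has_sum A) (UNIV \<times> UNIV)"
    using a_sum by (auto simp: summable_on_def)
  then have A': "((\<lambda>(j, i). a (i, j)) has_sum A) (UNIV \<times> UNIV)"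
    by (rule has_sum_swap[THEN iffD1])
  have "((\<lambda>i. pi / 4 * (tan_term x i / x)) has_sum A) UNIV"
    by (rule has_sum_SigmaD[OF A row])
  then have tan_sums: "tan_term x sums (4 * x / pi * A)"
    using sums_mult[OF has_sum_imp_sums, of "\<lambda>i. pi / 4 * (tan_term x i / x)" A "4 * x / pi"] x0 by simp
  have "((\<lambda>j. pi / 4 * (1 / (2 * real j + 1)\<^sup>2 - f_term (1 / x / 2) j)) has_sum A) UNIV"
    using col by (intro has_sum_SigmaD[OF A']) simp
  then have "(\<lambda>j. 4 / pi * (pi / 4 * (1 / (2 * real j + 1)\<^sup>2 - f_term (1 / x / 2) j))) sums (4 / pi * A)"
    by (intro sums_mult has_sum_imp_sums)
  from sums_diff[OF inverse_odd_squares_sums this]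
  have "f_term (1 / x / 2) sums (pi\<^sup>2 / 8 - 4 / pi * A)"
    by (simp add: field_simps)
  with tan_sums show thesis
    using x0 by (intro that[of "4 * x / pi * A"]) simp_all
qed

lemma tan_term_add_even: "tan_term (x + 2 * of_int k) = tan_term x"
proof
  fix i
  have "(2 * real i + 1) * pi * (x + 2 * of_int k) / 2
      = (2 * real i + 1) * pi * x / 2 + of_int ((2 * int i + 1) * k) * pi"
    by (simp add: field_simps)
  then show "tan_term (x + 2 * of_int k) i = tan_term x i"
    unfolding tan_term_def by (simp only: tan_periodic_int)
qed

text \<open>The angle moves by \<open>(2 * j + 1) * k\<close> half-turns, a number of the same
  parity as \<open>k\<close>.\<close>

lemma f_term_add_int: "f_term (r + of_int k) j = (if even k then f_term r j else - f_term r j)"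
proof -
  define l where "l = (2 * int j + 1) * k"
  have "(2 * real j + 1) * pi * (r + of_int k) = (2 * real j + 1) * pi * r + pi * of_int l"
    by (simp add: l_def algebra_simps)
  moreover have "cos (pi * of_int l) = (if even k then 1 else - 1)" "sin (pi * of_int l) = 0"
    by (simp_all add: l_def del: of_int_mult of_int_add)
  ultimately show ?thesis
    unfolding f_term_def sec_def by (simp only: cos_add) simp
qed

section \<open>Evaluation at quadratic irrationals\<close>

text \<open>Liouville's argument: \<open>a * n^2 - b * m^2\<close> is a nonzero integer, hence of
  size at least 1, and it equals \<open>a * (n - m * x) * (n + m * x)\<close>. If the first linear
  factor is below 1 in size, the second is at most \<open>2 * \<bar>x\<bar> + 1\<close> times the
  size of \<open>m\<close>; this yields \<open>c\<close>.\<close>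

lemma badly_approximable_quadratic:
  fixes a b :: int
  assumes "a \<noteq> 0" and eq: "of_int a * x\<^sup>2 = of_int b" and nonsquare: "\<And>w. a * b \<noteq> w\<^sup>2"
  shows "badly_approximable x"
proof -
  define c where "c = 1 / (\<bar>of_int a\<bar> * (2 * \<bar>x\<bar> + 1))"
  have a1: "\<bar>real_of_int a\<bar> \<ge> 1"
    using \<open>a \<noteq> 0\<close> by linarith
  have pos: "\<bar>of_int a\<bar> * (2 * \<bar>x\<bar> + 1) \<ge> 1"
    using a1 mult_mono[of 1 "\<bar>real_of_int a\<bar>" 1 "2 * \<bar>x\<bar> + 1"] by simp
  have c: "c > 0" "c \<le> 1"
    using pos by (auto simp: c_def divide_simps)
  have "c / \<bar>of_int m\<bar> \<le> \<bar>of_int n - of_int m * x\<bar>" if "m \<noteq> 0" for m n :: int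
  proof (cases "\<bar>of_int n - of_int m * x\<bar> < 1")
    case False
    have "c / \<bar>of_int m\<bar> \<le> 1"
      using c that by (simp add: divide_simps)
    with False show ?thesis
      by linarith
  next
    case True
    have m1: "\<bar>real_of_int m\<bar> \<ge> 1"
      using that by linarith
    \<comment> \<open>Multiplying a vanishing form by \<open>a\<close> gives
      \<open>(a * n)^2 = m^2 * (a * b)\<close>, so \<open>m\<close> divides \<open>a * n\<close> and
      \<open>a * b\<close> is a square.\<close>
    have "a * n\<^sup>2 - m\<^sup>2 * b \<noteq> 0"
    proof
      assume "a * n\<^sup>2 - m\<^sup>2 * b = 0"
      then have sq: "(a * n)\<^sup>2 = m\<^sup>2 * (a * b)"
        by (simp add: power2_eq_square algebra_simps)
      then have "m\<^sup>2 dvd (a * n)\<^sup>2"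
        by simp
      then have "m dvd a * n"
        by simp
      then obtain w where "a * n = m * w"
        by (elim dvdE)
      with sq that have "a * b = w\<^sup>2"
        by (simp add: power_mult_distrib)
      with nonsquare show False
        by blast
    qed
    then have "1 \<le> \<bar>real_of_int (a * n\<^sup>2 - m\<^sup>2 * b)\<bar>"
      by linarith
    also have "real_of_int (a * n\<^sup>2 - m\<^sup>2 * b) = of_int a * ((of_int n - of_int m * x) * (of_int n + of_int m * x))"
      by (simp add: eq[symmetric] power2_eq_square algebra_simps)
    also have "\<bar>\<dots>\<bar> = \<bar>of_int n - of_int m * x\<bar> * (\<bar>of_int a\<bar> * \<bar>of_int n + of_int m * x\<bar>)"
      by (simp add: abs_mult)
    also have "\<bar>of_int n + of_int m * x\<bar> \<le> \<bar>of_int m\<bar> * (2 * \<bar>x\<bar> + 1)"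
    proof -
      have "\<bar>of_int n + of_int m * x\<bar> \<le> \<bar>of_int n - of_int m * x\<bar> + 2 * (\<bar>of_int m\<bar> * \<bar>x\<bar>)"
        unfolding abs_mult[symmetric] by linarith
      with True m1 show ?thesis
        by (simp add: algebra_simps)
    qed
    finally have "1 \<le> \<bar>of_int n - of_int m * x\<bar> * (\<bar>of_int a\<bar> * (\<bar>of_int m\<bar> * (2 * \<bar>x\<bar> + 1)))"
      by (simp add: mult_left_mono)
    then have "1 / (\<bar>of_int a\<bar> * (\<bar>of_int m\<bar> * (2 * \<bar>x\<bar> + 1))) \<le> \<bar>of_int n - of_int m * x\<bar>"
      using a1 m1 by (subst pos_divide_le_eq) (auto intro!: mult_pos_pos)
    then show ?thesis
      by (simp add: c_def mult_ac)
  qed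
  with c(1) show ?thesis
    unfolding badly_approximable_def by blast
qed

text \<open>Otherwise \<open>(2 * w + 1)^2\<close> and \<open>(2 * v)^2\<close> would differ by 1.
  It is applied to \<open>w = 2 * p * K\<close>, for which
  \<open>w * (w + 1) = p * q\<close>.\<close>

lemma mult_add_one_not_square:
  fixes w v :: int
  assumes "w \<noteq> 0" and "w \<noteq> - 1"
  shows "w * (w + 1) \<noteq> v\<^sup>2"
proof
  assume eq: "w * (w + 1) = v\<^sup>2"
  have "(2 * w + 1 - 2 * v) * (2 * w + 1 + 2 * v) = 1"
    using eq by (simp add: power2_eq_square algebra_simps)
  then have "2 * w + 1 - 2 * v = 1 \<and> 2 * w + 1 + 2 * v = 1 \<or> 2 * w + 1 - 2 * v = - 1 \<and> 2 * w + 1 + 2 * v = - 1"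
    by (simp only: zmult_eq_1_iff)
  with assms show False
    by auto
qed

theorem theorem3p2:
  fixes K :: nat and p :: int and q :: int
  assumes "K > 0" and "p \<noteq> 0"
    and "q = 2 * int K * (2 * p * int K + 1)"
  shows "summable (f_term (sqrt (real_of_int p / real_of_int q) / 2))
    \<and> f (sqrt (real_of_int p / real_of_int q) / 2) =
        (if even p then 1 / 2 else 1 / 2 - real K / real_of_int q)"
proof -
  \<comment> \<open>Parity rules out the value -1, hence \<open>q = 0\<close>.\<close>
  have "even (2 * p * int K)"
    by simp
  then have pK: "2 * p * int K \<noteq> 0" "2 * p * int K \<noteq> - 1"
    using assms(1,2) by (simp, metis odd_one even_minus)
  have q0: "q \<noteq> 0"
    using assms(1,3) pK by auto
  have pq: "of_int p / real_of_int q > 0"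
  proof -
    have "p * q = (2 * p * int K) * (2 * p * int K + 1)"
      by (simp add: assms(3) algebra_simps)
    also have "\<dots> > 0"
    proof -
      have "w * (w + 1) > 0" if "w \<noteq> 0" "w \<noteq> - 1" for w :: int
        using that by (cases "w > 0") (auto intro!: mult_neg_neg)
      with pK show ?thesis
        by blast
    qed
    finally show ?thesis
      by (simp add: zero_less_mult_iff zero_less_divide_iff)
  qed
  define \<alpha> where "\<alpha> = sqrt (real_of_int p / real_of_int q)"
  define \<beta> where "\<beta> = 1 / \<alpha>"
  have \<alpha>: "\<alpha> > 0" "\<alpha>\<^sup>2 = of_int p / of_int q"
    using pq by (simp_all add: \<alpha>_def)
  have \<beta>0: "\<beta> > 0" and \<alpha>\<beta>: "\<alpha> = 1 / \<beta>"
    using \<alpha> by (simp_all add: \<beta>_def)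
  have \<beta>2: "of_int p * \<beta>\<^sup>2 = of_int q"
    using \<alpha>(2) assms(2) q0 by (simp add: \<beta>_def power_divide)
  have bad: "badly_approximable \<beta>"
  proof (rule badly_approximable_quadratic[OF assms(2) \<beta>2])
    show "p * q \<noteq> w\<^sup>2" for w
      using mult_add_one_not_square[OF pK, of w] by (simp add: assms(3) algebra_simps)
  qed
  define \<gamma> where "\<gamma> = \<beta> + 2 * of_int (- int K)"
  define \<delta> where "\<delta> = \<beta> + 2 * of_int (int K)"
  have bad': "badly_approximable \<gamma>" "badly_approximable \<delta>"
    using badly_approximable_add_int[OF bad, of "2 * (- int K)"]
      badly_approximable_add_int[OF bad, of "2 * int K"] by (simp_all add: \<gamma>_def \<delta>_def)
  note nz = badly_approximable_neq_0[OF bad'(1)] badly_approximable_neq_0[OF bad'(2)]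
  obtain T where T: "tan_term \<beta> sums T" "f_term (\<alpha> / 2) sums (pi\<^sup>2 / 8 - T / \<beta>)"
    using secant_tangent_reciprocity[OF bad] unfolding \<alpha>\<beta> .
  have shift: "tan_term \<gamma> = tan_term \<beta>" "tan_term \<delta> = tan_term \<beta>"
    unfolding \<gamma>_def \<delta>_def by (simp_all only: tan_term_add_even)
  \<comment> \<open>The tangent series at \<gamma> is termwise the one at \<beta>, so uniqueness of
    sums identifies its value with \<open>T\<close>.\<close>
  have \<gamma>: "f_term (1 / \<gamma> / 2) sums (pi\<^sup>2 / 8 - T / \<gamma>)"
    using secant_tangent_reciprocity[OF bad'(1)] T(1) sums_unique2 unfolding shift by metis
  have \<delta>: "f_term (1 / \<delta> / 2) sums (pi\<^sup>2 / 8 - T / \<delta>)"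
    using secant_tangent_reciprocity[OF bad'(2)] T(1) sums_unique2 unfolding shift by metis
  \<comment> \<open>The form of \<open>q\<close> enters here: \<beta> has square
    \<open>q / p = 4 * K^2 + 2 * K / p\<close>.\<close>
  have \<gamma>\<delta>: "of_int p * (\<gamma> * \<delta>) = 2 * real K"
    using \<beta>2 by (simp add: \<gamma>_def \<delta>_def assms(3) power2_eq_square algebra_simps)
  have diff: "1 / \<gamma> = 1 / \<delta> + 2 * of_int p"
  proof -
    have "\<delta> = \<gamma> + 2 * (of_int p * (\<gamma> * \<delta>))"
      unfolding \<gamma>\<delta> by (simp add: \<gamma>_def \<delta>_def)
    then show ?thesis
      using nz by (simp add: field_simps)
  qed
  \<comment> \<open>Halving turns the shift \<open>2 * p\<close> into \<open>p\<close>, whose parity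
    decides the sign.\<close>
  then have arg: "1 / \<gamma> / 2 = 1 / \<delta> / 2 + of_int p"
    by simp
  show ?thesis
  proof (cases "even p")
    case True
    then have "f_term (1 / \<gamma> / 2) = f_term (1 / \<delta> / 2)"
      unfolding arg by (simp add: f_term_add_int fun_eq_iff)
    then have "T / \<gamma> = T / \<delta>"
      using sums_unique2 \<gamma> \<delta> by force
    then have "T * (1 / \<gamma> - 1 / \<delta>) = 0"
      by (simp add: algebra_simps)
    then have "T = 0"
      using diff assms(2) by simp
    then have "f_term (\<alpha> / 2) sums (pi\<^sup>2 / 8)"
      using T(2) by simp
    then show ?thesis
      using True by (simp add: f_def sums_iff \<alpha>_def)
  next
    case False
    then have "f_term (1 / \<gamma> / 2) = (\<lambda>j. - f_term (1 / \<delta> / 2) j)"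
      unfolding arg by (simp add: f_term_add_int fun_eq_iff)
    then have "pi\<^sup>2 / 8 - T / \<gamma> = - (pi\<^sup>2 / 8 - T / \<delta>)"
      using sums_unique2[OF \<gamma>] sums_minus[OF \<delta>] by simp
    then have "T * (1 / \<gamma> + 1 / \<delta>) = pi\<^sup>2 / 4"
      by (simp add: algebra_simps)
    moreover have "1 / \<gamma> + 1 / \<delta> = of_int p * \<beta> / real K"
    proof -
      have "1 / \<gamma> + 1 / \<delta> = 2 * \<beta> / (\<gamma> * \<delta>)"
        using nz by (simp add: field_simps) (simp add: \<gamma>_def \<delta>_def)
      also have "\<gamma> * \<delta> = 2 * real K / of_int p"
        using \<gamma>\<delta> assms(2) by (simp add: field_simps)
      finally show ?thesis
        by simp
    qed
    ultimately have "T * (of_int p * \<beta> / real K) = pi\<^sup>2 / 4"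
      by (simp only:)
    then have "T * (of_int p * \<beta>) = pi\<^sup>2 / 4 * real K"
      using assms(1) by (simp add: field_simps)
    \<comment> \<open>Reciprocity at \<beta> involves \<open>T / \<beta>\<close>; in this form
      \<open>p * \<beta>^2\<close> can be replaced by \<open>q\<close>.\<close>
    then have "T / \<beta> * (of_int p * \<beta>\<^sup>2) = pi\<^sup>2 / 4 * real K"
      using \<beta>0 by (simp add: power2_eq_square field_simps)
    then have "T / \<beta> = pi\<^sup>2 / 4 * (real K / of_int q)"
      using q0 by (simp add: \<beta>2 field_simps)
    then have "f_term (\<alpha> / 2) sums (pi\<^sup>2 / 8 - pi\<^sup>2 / 4 * (real K / of_int q))"
      using T(2) by simp
    then have "summable (f_term (\<alpha> / 2))" "f (\<alpha> / 2) = 4 / pi\<^sup>2 * (pi\<^sup>2 / 8 - pi\<^sup>2 / 4 * (real K / of_int q))"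
      by (simp_all add: f_def sums_iff)
    then show ?thesis
      using False by (simp add: \<alpha>_def right_diff_distrib)
  qed
qed

end
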